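(* Let $\mathcal{G}=(\mathcal{V},\mathcal{E})$ be an undirected graph on $n\ge 2$ nodes with largest and second largest degrees $\Delta_1\ge\Delta_2$, and let $k>0$ satisfy $k>\frac{\Delta_1-\Delta_2}{\Delta_2+1}$. Consider the Stackelberg attacker-defender game with payoff $J_1(\mathfrak{F},\mathfrak{D})$, a single attacked node and a single defense node ($|\mathfrak{F}|=|\mathfrak{D}|=1$), and the defender as the game leader. Then an equilibrium strategy is that the defender chooses $v\in\arg\max_{i\in\mathcal{V}}d_i$, i.e. a node with the largest degree; in this case the attacker's best response is $\bar v\in\arg\max_{i\in\mathcal{V}\setminus\{v\}}d_i$, i.e. a node with the second largest degree.
   Context: $\mathcal{G}$ is simple, undirected and unweighted, and $d_i$ is the degree of node $i$. The degrees are counted with multiplicity: $\Delta_1\ge\Delta_2$ are the first two entries of the degree sequence sorted in non-increasing order. For a set $\mathfrak{D}\subseteq\mathcal{V}$ of defense nodes, $D_y=\mathrm{diag}(y)$ with $y_i=1$ if $i\in\mathfrak{D}$ and $y_i=0$ otherwise, and $H=I_n+kD_y$. For a set $\mathfrak{F}\subseteq\mathcal{V}$ of attacked nodes the payoff is $$J_1(\mathfrak{F},\mathfrak{D})=\frac12\sum_{i\in\mathfrak{F}}H^{-1}_{ii}d_i+\frac12\sum_{i\in\mathfrak{F}}H^{-1}_{ii},$$ where $H^{-1}_{ii}$ is the $i$-th diagonal element of $H^{-1}$. Stackelberg game with the defender as leader: the defender first chooses $\mathfrak{D}$ and the attacker, knowing $\mathfrak{D}$, chooses a best response $\mathfrak{F}\in\arg\max_{\mathfrak{F}}J_1(\mathfrak{F},\mathfrak{D})$.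 An equilibrium is a pair $(\mathfrak{D}^*,\mathfrak{F}^* )$ such that $\mathfrak{D}^*$ minimizes $\max_{\mathfrak{F}}J_1(\mathfrak{F},\mathfrak{D})$ over admissible $\mathfrak{D}$, and $\mathfrak{F}^*$ maximizes $J_1(\mathfrak{F},\mathfrak{D}^* )$ over admissible $\mathfrak{F}$ (here admissible sets are the singletons). *)

theory Defs
  imports "HOL-Analysis.Analysis" "HOL-Library.Multiset"
begin

text \<open>The vertex set is the finite type \<open>'n\<close>; a graph is given by its adjacency relation.\<close>

definition simple_graph :: "('n \<Rightarrow> 'n \<Rightarrow> bool) \<Rightarrow> bool" where
  "simple_graph E \<longleftrightarrow> symp E \<and> irreflp E"

definition deg :: "('n::finite \<Rightarrow> 'n \<Rightarrow> bool) \<Rightarrow> 'n \<Rightarrow> nat" where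
  "deg E i = card {j. E i j}"

definition degree_sequence :: "('n::finite \<Rightarrow> 'n \<Rightarrow> bool) \<Rightarrow> nat list" where
  "degree_sequence E = rev (sorted_list_of_multiset (image_mset (deg E) (mset_set UNIV)))"

text \<open>Degrees are counted with multiplicity, so the two values below coincide if
  the largest degree is attained twice. The second one is meaningful only if there are
  at least two vertices.\<close>

definition max_degree :: "('n::finite \<Rightarrow> 'n \<Rightarrow> bool) \<Rightarrow> nat" where
  "max_degree E = degree_sequence E ! 0"

definition second_degree :: "('n::finite \<Rightarrow> 'n \<Rightarrow> bool) \<Rightarrow> nat" where
  "second_degree E = degree_sequence E ! 1"

definition argmax_on :: "'a set \<Rightarrow> ('a \<Rightarrow> 'b::linorder) \<Rightarrow> 'a set" where
  "argmax_on A f = {x. is_arg_max f (\<lambda>y. y \<in> A) x}"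

definition diag :: "real ^ 'n \<Rightarrow> real ^ 'n ^ 'n" where
  "diag y = (\<chi> i j. if i = j then y $ i else 0)"

definition H_mat :: "real \<Rightarrow> 'n set \<Rightarrow> real ^ 'n ^ 'n" where
  "H_mat k D = mat 1 + k *\<^sub>R diag (\<chi> i. if i \<in> D then 1 else 0)"

definition payoff ::
  "('n::finite \<Rightarrow> 'n \<Rightarrow> bool) \<Rightarrow> real \<Rightarrow> 'n set \<Rightarrow> 'n set \<Rightarrow> real" where
  "payoff E k F D =
     1/2 * (\<Sum>i\<in>F. matrix_inv (H_mat k D) $ i $ i * real (deg E i))
     + 1/2 * (\<Sum>i\<in>F. matrix_inv (H_mat k D) $ i $ i)"

definition admissible :: "'n set set" where
  "admissible = {S. card S = 1}"

definition best_responses ::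
  "('n::finite \<Rightarrow> 'n \<Rightarrow> bool) \<Rightarrow> real \<Rightarrow> 'n set \<Rightarrow> 'n set set" where
  "best_responses E k D = argmax_on admissible (\<lambda>F. payoff E k F D)"

text \<open>The defender \<open>D\<close> is the leader, the attacker \<open>F\<close> the follower.\<close>

definition stackelberg_equilibrium ::
  "('n::finite \<Rightarrow> 'n \<Rightarrow> bool) \<Rightarrow> real \<Rightarrow> 'n set \<Rightarrow> 'n set \<Rightarrow> bool" where
  "stackelberg_equilibrium E k D F \<longleftrightarrow>
     is_arg_min (\<lambda>D'. MAX F'\<in>admissible. payoff E k F' D') (\<lambda>D'. D' \<in> admissible) D
     \<and> F \<in> best_responses E k D"

end

theory Submission
  imports Defs
begin

text \<open>
  Since \<^term>\<open>H_mat k D\<close> is diagonal, so is its inverse, and an attack on a single node \<open>i\<close> is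
  worth \<open>(d\<^sub>i + 1) / 2\<close> if \<open>i\<close> is undefended and \<open>(d\<^sub>i + 1) / (2 (1 + k))\<close> if it is defended
  (\<open>payoff_singleton\<close>). The game is therefore a comparison of degrees.

  Whatever the defender does, the attacker can secure \<open>(\<Delta>\<^sub>2 + 1) / 2\<close>: of the two
  nodes of largest degree, at least one is undefended. So no defense can push the attacker's
  optimum below this value. Defending a node \<open>v\<close> of largest degree attains it, because the
  hypothesis on \<open>k\<close> is precisely the inequality \<open>(\<Delta>\<^sub>1 + 1) / (1 + k) < \<Delta>\<^sub>2 + 1\<close>
  (\<open>defended_value_less_iff\<close>): attacking \<open>v\<close> is then strictly worse than attacking an
  undefended node of degree \<open>\<Delta>\<^sub>2\<close>, and among the undefended nodes the payoff increases
  with the degree.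
\<close>

lemma argmax_on_iff:
  "x \<in> argmax_on A f \<longleftrightarrow> x \<in> A \<and> (\<forall>y\<in>A. f y \<le> f x)"
  by (auto simp: argmax_on_def is_arg_max_def not_less)

lemma diag_mult_diag:
  fixes a b :: "real ^ 'n"
  shows "diag a ** diag b = diag (\<chi> i. a $ i * b $ i)"
proof -
  have "(\<Sum>l\<in>UNIV. diag a $ i $ l * diag b $ l $ j) = diag (\<chi> i. a $ i * b $ i) $ i $ j" for i j
  proof -
    have "(\<Sum>l\<in>UNIV. diag a $ i $ l * diag b $ l $ j)
        = (\<Sum>l\<in>UNIV. if i = l then a $ i * diag b $ l $ j else 0)"
      by (rule sum.cong) (simp_all add: diag_def)
    then show ?thesis
      by (simp add: diag_def)
  qed
  then show ?thesis
    by (simp add: matrix_matrix_mult_def vec_eq_iff)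
qed

lemma matrix_inv_diag:
  fixes y :: "real ^ 'n"
  assumes "\<And>i. y $ i \<noteq> 0"
  shows "matrix_inv (diag y) = diag (\<chi> i. inverse (y $ i))"
proof -
  let ?B = "diag (\<chi> i. inverse (y $ i))"
  have right: "diag y ** ?B = mat 1" and left: "?B ** diag y = mat 1"
    using assms by (simp_all add: diag_mult_diag) (simp_all add: diag_def mat_def vec_eq_iff)
  have "diag y ** matrix_inv (diag y) = mat 1 \<and> matrix_inv (diag y) ** diag y = mat 1"
    unfolding matrix_inv_def by (rule someI [where x = ?B]) (simp add: left right)
  then have inv: "matrix_inv (diag y) ** diag y = mat 1"
    by simp
  have "matrix_inv (diag y) = matrix_inv (diag y) ** (diag y ** ?B)"
    by (simp add: right)
  also have "\<dots> = (matrix_inv (diag y) ** diag y) ** ?B"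
    by (rule matrix_mul_assoc)
  also have "\<dots> = ?B"
    by (simp add: inv)
  finally show ?thesis .
qed

lemma H_mat_eq_diag:
  "H_mat k D = diag (\<chi> i. if i \<in> D then 1 + k else 1)"
  by (simp add: H_mat_def diag_def mat_def vec_eq_iff)

lemma payoff_singleton:
  fixes E :: "'n::finite \<Rightarrow> 'n \<Rightarrow> bool"
  assumes "k > 0"
  shows "payoff E k {i} D = (real (deg E i) + 1) / (if i \<in> D then 2 * (1 + k) else 2)"
  using assms
  by (simp add: payoff_def H_mat_eq_diag matrix_inv_diag)
    (simp add: diag_def field_simps)

lemma admissible_eq_singletons: "admissible = range (\<lambda>i. {i})"
  by (auto simp: admissible_def card_1_singleton_iff)

text \<open>Peeling maxima off a multiset one at a time reads off its decreasing enumeration from the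
  front; applied twice, this identifies \<open>\<Delta>\<^sub>1\<close> and \<open>\<Delta>\<^sub>2\<close> with degrees of actual nodes.\<close>

lemma rev_sorted_list_of_add_mset_max:
  assumes "\<And>x. x \<in># M \<Longrightarrow> x \<le> a"
  shows "rev (sorted_list_of_multiset (add_mset a M)) = a # rev (sorted_list_of_multiset M)"
proof -
  let ?xs = "sorted_list_of_multiset M"
  have "sorted (?xs @ [a])"
    using assms by (simp add: sorted_append)
  moreover have "mset (?xs @ [a]) = add_mset a M"
    by simp
  ultimately have "sorted_list_of_multiset (add_mset a M) = ?xs @ [a]"
    by (metis sorted_list_of_multiset_mset sorted_sort_id)
  then show ?thesis
    by simp
qed

lemma degree_sequence_two_largest:
  fixes E :: "'n::finite \<Rightarrow> 'n \<Rightarrow> bool"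
  assumes v: "v \<in> argmax_on UNIV (deg E)" and w: "w \<in> argmax_on (UNIV - {v}) (deg E)"
  shows "max_degree E = deg E v" and "second_degree E = deg E w"
proof -
  define S where "S = UNIV - {v, w}"
  let ?R = "image_mset (deg E) (mset_set S)"
  have "w \<noteq> v"
    using w by (simp add: argmax_on_iff)
  then have "v \<notin> insert w S" and "w \<notin> S" and "UNIV = insert v (insert w S)"
    by (auto simp: S_def)
  have "mset_set UNIV = mset_set (insert v (insert w S))"
    using \<open>UNIV = insert v (insert w S)\<close> by (rule arg_cong)
  also have "\<dots> = add_mset v (add_mset w (mset_set S))"
    using \<open>v \<notin> insert w S\<close> \<open>w \<notin> S\<close> by (simp del: insert_iff)
  finally have "mset_set UNIV = add_mset v (add_mset w (mset_set S))" .
  moreover have "x \<le> deg E w" if "x \<in># ?R" for x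
    using w that by (auto simp: argmax_on_iff S_def)
  moreover have "x \<le> deg E v" if "x \<in># add_mset (deg E w) ?R" for x
    using v that by (auto simp: argmax_on_iff)
  ultimately have "degree_sequence E = deg E v # deg E w # rev (sorted_list_of_multiset ?R)"
    by (simp only: degree_sequence_def image_mset_add_mset rev_sorted_list_of_add_mset_max)
  then show "max_degree E = deg E v" and "second_degree E = deg E w"
    by (simp_all add: max_degree_def second_degree_def)
qed

lemma defended_value_less_iff:
  fixes k a b :: real
  assumes "k > 0" and "b \<ge> 0"
  shows "(a + 1) / (2 * (1 + k)) < (b + 1) / 2 \<longleftrightarrow> k > (a - b) / (b + 1)"
proof -
  have "(a + 1) / (2 * (1 + k)) < (b + 1) / 2 \<longleftrightarrow> a + 1 < (b + 1) / 2 * (2 * (1 + k))"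
    using assms by (intro pos_divide_less_eq) simp
  also have "(b + 1) / 2 * (2 * (1 + k)) = (b + 1) * (1 + k)"
    by simp
  also have "a + 1 < \<dots> \<longleftrightarrow> a - b < k * (b + 1)"
    by (simp add: algebra_simps)
  also have "\<dots> \<longleftrightarrow> k > (a - b) / (b + 1)"
    using assms by (intro pos_divide_less_eq [symmetric]) simp
  finally show ?thesis .
qed

text \<open>An attack on the defended node earns strictly less than one on the best undefended node,
  so it never enters the maximization.\<close>

lemma best_responses_defended_max:
  fixes E :: "'n::finite \<Rightarrow> 'n \<Rightarrow> bool"
  assumes "k > 0"
    and w: "w \<in> argmax_on (UNIV - {v}) (deg E)"
    and less: "(real (deg E v) + 1) / (2 * (1 + k)) < (real (deg E w) + 1) / 2"
  shows "best_responses E k {v} = (\<lambda>u. {u}) ` argmax_on (UNIV - {v}) (deg E)"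
proof -
  have "w \<noteq> v"
    using w by (simp add: argmax_on_iff)
  have "{u} \<in> best_responses E k {v} \<longleftrightarrow> u \<in> argmax_on (UNIV - {v}) (deg E)" for u
  proof
    assume "{u} \<in> best_responses E k {v}"
    then have le: "payoff E k {x} {v} \<le> payoff E k {u} {v}" for x
      by (simp add: best_responses_def argmax_on_iff admissible_eq_singletons)
    have "u \<noteq> v"
      using le[of w] less \<open>w \<noteq> v\<close> \<open>k > 0\<close> by (auto simp: payoff_singleton)
    moreover have "deg E x \<le> deg E u" if "x \<noteq> v" for x
      using le[of x] that \<open>u \<noteq> v\<close> \<open>k > 0\<close> by (simp add: payoff_singleton)
    ultimately show "u \<in> argmax_on (UNIV - {v}) (deg E)"
      by (simp add: argmax_on_iff)
  next
    assume u: "u \<in> argmax_on (UNIV - {v}) (deg E)"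
    then have "u \<noteq> v" and "deg E w \<le> deg E u"
      using w by (simp_all add: argmax_on_iff)
    have "payoff E k {x} {v} \<le> payoff E k {u} {v}" for x
    proof (cases "x = v")
      case True
      have "(real (deg E w) + 1) / 2 \<le> (real (deg E u) + 1) / 2"
        using \<open>deg E w \<le> deg E u\<close> by simp
      with less have "(real (deg E v) + 1) / (2 * (1 + k)) \<le> (real (deg E u) + 1) / 2"
        by linarith
      then show ?thesis
        using True \<open>u \<noteq> v\<close> \<open>k > 0\<close> by (simp add: payoff_singleton)
    next
      case False
      then show ?thesis
        using u \<open>u \<noteq> v\<close> \<open>k > 0\<close> by (simp add: payoff_singleton argmax_on_iff)
    qed
    then show "{u} \<in> best_responses E k {v}"
      by (auto simp: best_responses_def argmax_on_iff admissible_eq_singletons)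
  qed
  moreover have "best_responses E k {v} \<subseteq> range (\<lambda>u. {u})"
    by (auto simp: best_responses_def argmax_on_iff admissible_eq_singletons)
  ultimately show ?thesis
    by blast
qed

lemma Max_payoff_eq_best_response:
  fixes E :: "'n::finite \<Rightarrow> 'n \<Rightarrow> bool"
  assumes "F \<in> best_responses E k D"
  shows "(MAX F'\<in>admissible. payoff E k F' D) = payoff E k F D"
  using assms by (intro Max_eqI) (auto simp: best_responses_def argmax_on_iff)

text \<open>Against any single defended node \<open>u\<close> the attacker still has \<open>v\<close> (if \<open>u \<noteq> v\<close>) or \<open>w\<close>
  (if \<open>u = v\<close>) at full value. This bounds the value of every defense from below.\<close>

lemma Max_payoff_ge_undefended:
  fixes E :: "'n::finite \<Rightarrow> 'n \<Rightarrow> bool"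
  assumes "k > 0" and "D \<in> admissible" and "w \<noteq> v" and "deg E w \<le> deg E v"
  shows "(real (deg E w) + 1) / 2 \<le> (MAX F\<in>admissible. payoff E k F D)"
proof -
  obtain x where "x \<notin> D" and "deg E w \<le> deg E x"
    using assms(2-4) by (cases "v \<in> D") (auto simp: admissible_eq_singletons)
  then have "(real (deg E w) + 1) / 2 \<le> payoff E k {x} D"
    using \<open>k > 0\<close> by (simp add: payoff_singleton)
  also have "\<dots> \<le> (MAX F\<in>admissible. payoff E k F D)"
    by (intro Max_ge) (auto simp: admissible_eq_singletons)
  finally show ?thesis .
qed

theorem theorem1:
  fixes E :: "'n::finite \<Rightarrow> 'n \<Rightarrow> bool" and k :: real and v :: 'n
  assumes "simple_graph E"
    and "CARD('n) \<ge> 2"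
    and "k > 0"
    and "k > (real (max_degree E) - real (second_degree E)) / (real (second_degree E) + 1)"
    and "v \<in> argmax_on UNIV (deg E)"
  shows "deg E v = max_degree E
    \<and> best_responses E k {v} = (\<lambda>w. {w}) ` argmax_on (UNIV - {v}) (deg E)
    \<and> (\<forall>w \<in> argmax_on (UNIV - {v}) (deg E).
          deg E w = second_degree E \<and> stackelberg_equilibrium E k {v} {w})"
proof -
  let ?A = "argmax_on (UNIV - {v}) (deg E)"
  have "UNIV \<noteq> {v}"
    using assms(2) by (metis card_1_singleton_iff One_nat_def Suc_1 not_less_eq_eq order_refl)
  then obtain x where "x \<noteq> v"
    by auto
  then have "UNIV - {v} \<noteq> {}"
    by auto
  then obtain w where "w \<in> UNIV - {v}" and w: "Max (deg E ` (UNIV - {v})) = deg E w"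
    using obtains_MAX[of "UNIV - {v}" "deg E"] by (metis finite)
  then have "w \<in> ?A"
    using Max_ge[of "deg E ` (UNIV - {v})"] by (simp add: argmax_on_iff flip: w)
  have "(real (deg E v) + 1) / (2 * (1 + k)) < (real (deg E w) + 1) / 2"
    using assms(4) degree_sequence_two_largest[OF assms(5) \<open>w \<in> ?A\<close>]
    unfolding defended_value_less_iff[OF \<open>k > 0\<close> of_nat_0_le_iff] by simp
  then have responses: "best_responses E k {v} = (\<lambda>u. {u}) ` ?A"
    by (rule best_responses_defended_max[OF \<open>k > 0\<close> \<open>w \<in> ?A\<close>])
  have "stackelberg_equilibrium E k {v} {u}" if "u \<in> ?A" for u
  proof -
    have response: "{u} \<in> best_responses E k {v}"
      using responses that by blast
    have "u \<noteq> v" and "deg E u \<le> deg E v"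
      using that assms(5) by (simp_all add: argmax_on_iff)
    then have "(MAX F\<in>admissible. payoff E k F {v}) = (real (deg E u) + 1) / 2"
      using Max_payoff_eq_best_response[OF response] \<open>k > 0\<close> by (simp add: payoff_singleton)
    then have "(MAX F\<in>admissible. payoff E k F {v}) \<le> (MAX F\<in>admissible. payoff E k F D)"
      if "D \<in> admissible" for D
      using Max_payoff_ge_undefended[OF \<open>k > 0\<close> that \<open>u \<noteq> v\<close> \<open>deg E u \<le> deg E v\<close>] by simp
    moreover have "{v} \<in> admissible"
      by (simp add: admissible_def)
    ultimately show ?thesis
      using response by (simp add: stackelberg_equilibrium_def is_arg_min_linorder)
  qed
  moreover have "deg E v = max_degree E" and "\<forall>u\<in>?A. deg E u = second_degree E"
    using degree_sequence_two_largest[OF assms(5)] \<open>w \<in> ?A\<close> by simp_all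
  ultimately show ?thesis
    using responses by blast
qed

end
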